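(* Let $\mathcal{H}$ be a separable Hilbert space, let $K\in\mathcal{B}(\mathcal{H})$, and let $(\mathcal{X},\mathcal{Y})=(\{x_i\}_{i=1}^{\infty},\{y_i\}_{i=1}^{\infty})$ be a biframe for $\mathcal{H}$ with biframe operator $S_{\mathcal{X},\mathcal{Y}}$. Then $(\mathcal{X},\mathcal{Y})$ is a $K$-biframe for $\mathcal{H}$ if and only if there exists $A>0$ such that $S_{\mathcal{X},\mathcal{Y}}\geq A\,KK^{\ast}$.
   Context: $\mathcal{B}(\mathcal{H})$ is the set of bounded linear operators on $\mathcal{H}$. For $K\in\mathcal{B}(\mathcal{H})$, a pair $(\{x_i\}_{i=1}^{\infty},\{y_i\}_{i=1}^{\infty})$ of sequences in $\mathcal{H}$ is a $K$-biframe for $\mathcal{H}$ if there exist constants $0<A\leq B<\infty$ such that $A\|K^{\ast}x\|^2\leq\sum_{i=1}^{\infty}\langle x,x_i\rangle\langle y_i,x\rangle\leq B\|x\|^2$ for all $x\in\mathcal{H}$ (the inequalities include that the series converges to a real number). A biframe is a $K$-biframe with $K$ the identity operator. The biframe operator is $S_{\mathcal{X},\mathcal{Y}}:\mathcal{H}\to\mathcal{H}$, $S_{\mathcal{X},\mathcal{Y}}(x)=\sum_{i=1}^{\infty}\langle x,x_i\rangle y_i$. The inequality $S\geq T$ means $\langle Sx,x\rangle\geq\langle Tx,x\rangle$ for all $x\in\mathcal{H}$. *)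

theory Defs
  imports "HOL-Analysis.Analysis" "HOL-Library.Complex_Order"
begin

text \<open>
  Complex inner product spaces are built on top of \<^class>\<open>real_inner\<close>: the real inner product,
  and hence norm and topology, is that of the real part of the complex inner product, so that
  the norm of \<open>x\<close> is the square root of \<open>cinner x x\<close> (lemma \<open>cinner_self\<close> below).
  The complex inner product is linear in its \<^emph>\<open>first\<close> argument.
\<close>

class complex_inner = real_inner +
  fixes scaleC :: "complex \<Rightarrow> 'a \<Rightarrow> 'a" (infixr "*\<^sub>C" 75)
    and cinner :: "'a \<Rightarrow> 'a \<Rightarrow> complex"
  assumes scaleC_add_right: "c *\<^sub>C (x + y) = c *\<^sub>C x + c *\<^sub>C y"
    and scaleC_add_left: "(c + d) *\<^sub>C x = c *\<^sub>C x + d *\<^sub>C x"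
    and scaleC_scaleC: "c *\<^sub>C (d *\<^sub>C x) = (c * d) *\<^sub>C x"
    and scaleC_of_real: "complex_of_real r *\<^sub>C x = scaleR r x"
    and cinner_commute: "cinner x y = cnj (cinner y x)"
    and cinner_add_left: "cinner (x + y) z = cinner x z + cinner y z"
    and cinner_scaleC_left: "cinner (c *\<^sub>C x) y = c * cinner x y"
    and inner_eq_Re_cinner: "inner x y = Re (cinner x y)"

class complex_hilbert = complex_inner + complete_space

instantiation complex :: complex_hilbert
begin

definition scaleC_complex :: "complex \<Rightarrow> complex \<Rightarrow> complex"
  where "scaleC_complex = (*)"

definition cinner_complex :: "complex \<Rightarrow> complex \<Rightarrow> complex"
  where "cinner_complex x y = x * cnj y"

instance
  by standard
    (simp_all add: scaleC_complex_def cinner_complex_def inner_complex_def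
      scaleR_conv_of_real distrib_left distrib_right mult.assoc)

end

lemma cinner_self: "cinner x x = complex_of_real ((norm x)\<^sup>2)"
proof -
  have "Im (cinner x x) = Im (cnj (cinner x x))"
    by (rule arg_cong[OF cinner_commute])
  then show ?thesis
    by (simp add: complex_eq_iff power2_norm_eq_inner inner_eq_Re_cinner)
qed

definition bounded_clinear :: "('a::complex_inner \<Rightarrow> 'b::complex_inner) \<Rightarrow> bool"
  where "bounded_clinear K \<longleftrightarrow> bounded_linear K \<and> (\<forall>c x. K (c *\<^sub>C x) = c *\<^sub>C K x)"

text \<open>Meaningful for bounded complex-linear operators on a complex Hilbert space.\<close>

definition cadjoint :: "('a::complex_inner \<Rightarrow> 'a) \<Rightarrow> 'a \<Rightarrow> 'a"
  where "cadjoint K = (THE K'. \<forall>u v. cinner (K u) v = cinner u (K' v))"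

text \<open>Sequences are indexed from 0; the series need only converge conditionally.\<close>

definition K_biframe ::
    "('a::complex_inner \<Rightarrow> 'a) \<Rightarrow> (nat \<Rightarrow> 'a) \<Rightarrow> (nat \<Rightarrow> 'a) \<Rightarrow> bool"
  where "K_biframe K x y \<longleftrightarrow>
    (\<exists>A B::real. 0 < A \<and> A \<le> B \<and>
      (\<forall>u. \<exists>s::real. (\<lambda>i. cinner u (x i) * cinner (y i) u) sums complex_of_real s \<and>
        A * (norm (cadjoint K u))\<^sup>2 \<le> s \<and> s \<le> B * (norm u)\<^sup>2))"

definition biframe :: "(nat \<Rightarrow> 'a::complex_inner) \<Rightarrow> (nat \<Rightarrow> 'a) \<Rightarrow> bool"
  where "biframe x y \<longleftrightarrow> K_biframe (\<lambda>u. u) x y"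

text \<open>
  The sum of the series of \<open>cinner u (x i) *\<^sub>C y i\<close> in the weak topology.  A biframe always yields a
  weakly convergent series (polarization and the Riesz representation theorem), but not
  necessarily a norm convergent one: with an orthonormal basis \<open>e\<^sub>1, e\<^sub>2, \<dots>\<close> and \<open>e\<^sub>0 = 0\<close>, list the
  pairs \<open>(x i, y i)\<close> as \<open>(e\<^sub>1, e\<^sub>1), (e\<^sub>1, e\<^sub>1 - e\<^sub>0), (e\<^sub>2, e\<^sub>2), (e\<^sub>1, e\<^sub>2 - e\<^sub>1), (e\<^sub>3, e\<^sub>3), (e\<^sub>1, e\<^sub>3 - e\<^sub>2), \<dots>\<close>.
  Lemma \<open>biframe_operator_eq_suminf\<close> shows that this is the
  ordinary sum whenever the series converges in norm.
\<close>

definition biframe_operator ::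
    "(nat \<Rightarrow> 'a::complex_inner) \<Rightarrow> (nat \<Rightarrow> 'a) \<Rightarrow> 'a \<Rightarrow> 'a"
  where "biframe_operator x y u =
    (THE v. \<forall>z. (\<lambda>i. cinner (cinner u (x i) *\<^sub>C y i) z) sums cinner v z)"

lemma bounded_linear_cinner_left: "bounded_linear (\<lambda>v. cinner v z)"
proof -
  have re: "Re (cinner v w) = inner v w" for v w :: 'a
    by (simp add: inner_eq_Re_cinner)
  have im: "Im (cinner v z) = inner v (\<i> *\<^sub>C z)" for v
  proof -
    have "cinner v (\<i> *\<^sub>C z) = cnj (cinner (\<i> *\<^sub>C z) v)"
      by (rule cinner_commute)
    also have "\<dots> = - \<i> * cnj (cinner z v)"
      by (simp add: cinner_scaleC_left)
    also have "cnj (cinner z v) = cinner v z"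
      by (rule cinner_commute[symmetric])
    finally show ?thesis
      by (simp add: inner_eq_Re_cinner)
  qed
  have "(\<lambda>v. cinner v z) = (\<lambda>v. of_real (inner v z) + \<i> * of_real (inner v (\<i> *\<^sub>C z)))"
    by (simp add: fun_eq_iff complex_eq_iff re im)
  moreover have "bounded_linear (\<lambda>v. complex_of_real (inner v z) + \<i> * of_real (inner v (\<i> *\<^sub>C z)))"
    by (intro bounded_linear_add bounded_linear_const_mult
        bounded_linear_compose[OF bounded_linear_of_real] bounded_linear_inner_left)
  ultimately show ?thesis by simp
qed

lemma cinner_left_ext:
  assumes "\<And>z. cinner v z = cinner w z"
  shows "v = w"
proof -
  have "inner (v - w) (v - w) = inner v (v - w) - inner w (v - w)"
    by (rule inner_diff_left)
  also have "\<dots> = 0"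
    by (simp add: inner_eq_Re_cinner assms)
  finally show ?thesis by simp
qed

lemma biframe_operator_eq_suminf:
  assumes "summable (\<lambda>i. cinner u (x i) *\<^sub>C y i)"
  shows "biframe_operator x y u = (\<Sum>i. cinner u (x i) *\<^sub>C y i)"
  unfolding biframe_operator_def
proof (rule the_equality)
  show weak: "\<forall>z. (\<lambda>i. cinner (cinner u (x i) *\<^sub>C y i) z) sums
      cinner (\<Sum>i. cinner u (x i) *\<^sub>C y i) z"
    using bounded_linear.sums[OF bounded_linear_cinner_left summable_sums[OF assms]] by blast
  show "v = (\<Sum>i. cinner u (x i) *\<^sub>C y i)"
    if "\<forall>z. (\<lambda>i. cinner (cinner u (x i) *\<^sub>C y i) z) sums cinner v z" for v
  proof (rule cinner_left_ext)
    fix z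
    show "cinner v z = cinner (\<Sum>i. cinner u (x i) *\<^sub>C y i) z"
      by (rule sums_unique2[OF that[rule_format] weak[rule_format]])
  qed
qed

text \<open>
  On \<^typ>\<open>complex\<close>, \<open>z \<le> w\<close> means equal imaginary parts and \<open>Re z \<le> Re w\<close>.
\<close>

definition op_ge :: "('a::complex_inner \<Rightarrow> 'a) \<Rightarrow> ('a \<Rightarrow> 'a) \<Rightarrow> bool"
  where "op_ge S T \<longleftrightarrow> (\<forall>u. cinner (T u) u \<le> cinner (S u) u)"

end

theory Submission
  imports Defs
begin

text \<open>
  Once \<open>S = biframe_operator x y\<close> and \<open>K\<^sup>* = cadjoint K\<close> are known to have their characteristic
  properties, \<open>\<langle>S u, u\<rangle>\<close> is the sum of the series \<open>\<Sum>i. \<langle>u, x i\<rangle> \<langle>y i, u\<rangle>\<close> and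
  \<open>\<langle>A K K\<^sup>* u, u\<rangle> = A \<parallel>K\<^sup>* u\<parallel>\<^sup>2\<close>, so that \<open>S \<ge> A K K\<^sup>*\<close> is precisely the lower \<open>K\<close>-biframe inequality
  with constant \<open>A\<close>.  The upper inequality is inherited from the biframe; since the bounds of a
  \<open>K\<close>-biframe must satisfy \<open>A \<le> B\<close>, \<open>A\<close> is replaced by \<open>min A B\<close> if necessary.

  The work lies in the two existence statements behind the definite descriptions.  Both rest on
  the Riesz representation theorem (\<open>riesz_representation\<close>), obtained by minimizing
  \<open>\<parallel>w\<parallel>\<^sup>2 - 2 f w\<close>.  For \<open>S\<close>, polarization turns the convergence of the quadratic series into
  convergence of \<open>\<Sum>i. \<langle>u, x i\<rangle> \<langle>y i, z\<rangle>\<close> for all \<open>u\<close> and \<open>z\<close>, and the upper biframe bound makes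
  the sum a bounded functional of \<open>z\<close> (\<open>biframe_operator_sums\<close>).
\<close>

section \<open>Riesz representation\<close>

lemma riesz_representation:
  fixes f :: "'a::{real_inner, complete_space} \<Rightarrow> real"
  assumes f: "bounded_linear f"
  obtains v where "\<And>z. f z = inner v z"
proof -
  interpret bounded_linear f by (rule f)
  define J where "J w = (norm w)\<^sup>2 - 2 * f w" for w
  obtain N where N: "\<And>w. norm (f w) \<le> norm w * N"
    using bounded by blast
  have "- N\<^sup>2 \<le> J w" for w
  proof -
    have "0 \<le> (norm w - N)\<^sup>2" by simp
    with N[of w] show ?thesis
      unfolding J_def by (simp add: power2_diff algebra_simps)
  qed
  then have bdd: "bdd_below (range J)"
    by (meson bdd_belowI2)
  define m where "m = (INF w. J w)"
  have m_le: "m \<le> J w" for w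
    unfolding m_def by (rule cINF_lower[OF bdd]) simp
  have "\<exists>w. J w < m + 1 / real (Suc n)" for n
  proof -
    have "m < m + 1 / real (Suc n)" by simp
    then show ?thesis
      using cINF_less_iff[OF UNIV_not_empty bdd] unfolding m_def by blast
  qed
  then obtain X where X: "\<And>n. J (X n) < m + 1 / real (Suc n)"
    by metis
  \<comment> \<open>The parallelogram law, expressed through \<open>J\<close>: the linear terms cancel.\<close>
  have para: "(norm (a - b))\<^sup>2 = 2 * J a + 2 * J b - 4 * J ((1/2) *\<^sub>R (a + b))" for a b
    unfolding J_def by (simp add: power2_norm_eq_inner add scaleR algebra_simps inner_commute)
  have "Cauchy X"
  proof (rule CauchyI)
    fix e :: real assume "e > 0"
    then obtain M where M: "1 / real (Suc M) < e\<^sup>2 / 4"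
      using nat_approx_posE[of "e\<^sup>2 / 4"] by (auto simp: field_simps)
    have "norm (X n - X k) < e" if "n \<ge> M" "k \<ge> M" for n k
    proof -
      have "1 / real (Suc n) \<le> 1 / real (Suc M)" "1 / real (Suc k) \<le> 1 / real (Suc M)"
        using that by (simp_all add: frac_le)
      with X[of n] X[of k] m_le[of "(1/2) *\<^sub>R (X n + X k)"] M
      have "(norm (X n - X k))\<^sup>2 < e\<^sup>2"
        unfolding para by linarith
      then show ?thesis
        using \<open>e > 0\<close> by (simp add: power2_less_imp_less)
    qed
    then show "\<exists>M. \<forall>n\<ge>M. \<forall>k\<ge>M. norm (X n - X k) < e"
      by blast
  qed
  then obtain v where v: "X \<longlonglongrightarrow> v"
    using Cauchy_convergent convergent_def by blast
  have "(\<lambda>n. J (X n)) \<longlonglongrightarrow> J v"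
    unfolding J_def by (intro tendsto_intros tendsto v)
  moreover have "(\<lambda>n. m + 1 / real (Suc n)) \<longlonglongrightarrow> m"
    using tendsto_add[OF tendsto_const lim_1_over_n[THEN LIMSEQ_Suc], of m] by simp
  ultimately have "J v \<le> m"
    by (rule LIMSEQ_le) (use X less_imp_le in blast)
  have "f z = inner v z" for z
  proof (rule ccontr)
    define d where "d = inner v z - f z"
    define q where "q = (norm z)\<^sup>2"
    assume "f z \<noteq> inner v z"
    then have "d \<noteq> 0" by (simp add: d_def)
    have "q \<ge> 0" by (simp add: q_def)
    \<comment> \<open>A small step from \<open>v\<close> against the slope \<open>2 d\<close> would push \<open>J\<close> below its infimum.\<close>
    have expand: "J (v + t *\<^sub>R z) = J v + 2 * t * d + t\<^sup>2 * q" for t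
      unfolding J_def d_def q_def
      by (simp add: power2_norm_eq_inner add scaleR algebra_simps inner_commute power2_eq_square[of t])
    \<comment> \<open>The summand 1 keeps the step length \<open>- d / r\<close> well defined for \<open>z = 0\<close> as well.\<close>
    define r where "r = q + 1"
    have "r > 0" and q_eq: "q = r - 1"
      using \<open>q \<ge> 0\<close> by (simp_all add: r_def)
    have "0 \<le> 2 * (- d / r) * d + (- d / r)\<^sup>2 * q"
      using expand[of "- d / r"] m_le[of "v + (- d / r) *\<^sub>R z"] \<open>J v \<le> m\<close>
      by linarith
    also have "\<dots> = - (d\<^sup>2 * (r + 1) / r\<^sup>2)"
      unfolding q_eq using \<open>r > 0\<close> by (simp add: field_simps power2_eq_square)
    also have "\<dots> < 0"
      using \<open>r > 0\<close> \<open>d \<noteq> 0\<close> by simp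
    finally show False by simp
  qed
  then show thesis by (rule that)
qed

section \<open>Complex inner products and the adjoint\<close>

lemma cinner_add_right: "cinner z (u + v) = cinner z u + cinner z v"
  by (metis cinner_add_left cinner_commute complex_cnj_add)

lemma cinner_scaleC_right: "cinner z (c *\<^sub>C u) = cnj c * cinner z u"
  by (metis cinner_commute cinner_scaleC_left complex_cnj_mult)

lemma cinner_right_ext:
  assumes "\<And>z. cinner z v = cinner z w"
  shows "v = w"
  by (rule cinner_left_ext) (metis assms cinner_commute)

lemma norm_scaleC: "norm (c *\<^sub>C (u::'a::complex_inner)) = cmod c * norm u"
proof -
  have "complex_of_real ((norm (c *\<^sub>C u))\<^sup>2) = (c * cnj c) * cinner u u"
    by (simp only: cinner_self[symmetric] cinner_scaleC_left cinner_scaleC_right mult_ac)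
  also have "\<dots> = complex_of_real ((cmod c * norm u)\<^sup>2)"
    by (simp only: complex_norm_square[symmetric] cinner_self of_real_mult power_mult_distrib)
  finally show ?thesis
    by (simp only: of_real_eq_iff power2_eq_iff_nonneg mult_nonneg_nonneg norm_ge_zero)
qed

text \<open>
  The complex form of the representation theorem, for conjugate-linear functionals: the real part
  is represented by \<open>riesz_representation\<close>, and replacing \<open>z\<close> by \<open>\<i> z\<close> recovers the imaginary part.
\<close>

lemma riesz_representation_complex:
  fixes g :: "'a::complex_hilbert \<Rightarrow> complex"
  assumes bounded: "bounded_linear g"
    and conj: "\<And>z. g (\<i> *\<^sub>C z) = - \<i> * g z"
  obtains v where "\<And>z. g z = cinner v z"
proof -
  have "bounded_linear (\<lambda>z. Re (g z))"
    by (rule bounded_linear_compose[OF bounded_linear_Re bounded])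
  then obtain v where v: "\<And>z. Re (g z) = inner v z"
    using riesz_representation by blast
  have "g z = cinner v z" for z
    using v[of z] v[of "\<i> *\<^sub>C z"]
    by (simp add: complex_eq_iff inner_eq_Re_cinner conj cinner_scaleC_right)
  then show thesis by (rule that)
qed

lemma cinner_cadjoint:
  fixes K :: "'a::complex_hilbert \<Rightarrow> 'a"
  assumes K: "bounded_clinear K"
  shows "cinner (K u) v = cinner u (cadjoint K v)"
proof -
  have "\<exists>w. \<forall>u. cinner (K u) v = cinner u w" for v
  proof -
    have "bounded_linear (\<lambda>u. cnj (cinner (K u) v))"
      using K unfolding bounded_clinear_def
      by (intro bounded_linear_compose[OF bounded_linear_cnj]
          bounded_linear_compose[OF bounded_linear_cinner_left]) auto
    moreover have "cnj (cinner (K (\<i> *\<^sub>C u)) v) = - \<i> * cnj (cinner (K u) v)" for u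
      using K unfolding bounded_clinear_def by (simp add: cinner_scaleC_left)
    ultimately obtain w where "\<And>u. cnj (cinner (K u) v) = cinner w u"
      using riesz_representation_complex by blast
    then show ?thesis by (metis cinner_commute complex_cnj_cnj)
  qed
  then obtain K' where K': "\<forall>u v. cinner (K u) v = cinner u (K' v)"
    by metis
  have "\<exists>!K'. \<forall>u v. cinner (K u) v = cinner u (K' v)"
  proof (rule ex1I)
    show "\<forall>u v. cinner (K u) v = cinner u (K' v)" by (rule K')
    fix L assume "\<forall>u v. cinner (K u) v = cinner u (L v)"
    with K' show "L = K'"
      by (metis ext cinner_right_ext)
  qed
  from theI'[OF this] show ?thesis
    unfolding cadjoint_def by blast
qed

section \<open>The biframe operator\<close>

lemma cinner_polarization:
  "4 * (cinner u x * cinner y z) =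
     cinner (u + z) x * cinner y (u + z) - cinner (u + (-1) *\<^sub>C z) x * cinner y (u + (-1) *\<^sub>C z)
     + \<i> * (cinner (u + \<i> *\<^sub>C z) x * cinner y (u + \<i> *\<^sub>C z))
     - \<i> * (cinner (u + (-\<i>) *\<^sub>C z) x * cinner y (u + (-\<i>) *\<^sub>C z))"
  by (simp add: cinner_add_left cinner_add_right cinner_scaleC_left cinner_scaleC_right
      algebra_simps)

text \<open>
  For the weak sum defining the biframe operator to exist, it is enough that the quadratic series
  converges to a nonnegative real number with an upper estimate; a strictly positive lower bound
  plays no role.
\<close>

lemma biframe_operator_sums:
  fixes x y :: "nat \<Rightarrow> 'a::complex_hilbert"
  assumes q: "\<And>u. (\<lambda>i. cinner u (x i) * cinner (y i) u) sums complex_of_real (q u)"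
    and q_nonneg: "\<And>u. 0 \<le> q u" and q_le: "\<And>u. q u \<le> B * (norm u)\<^sup>2"
    and B: "0 < B"
  shows "(\<lambda>i. cinner u (x i) * cinner (y i) z) sums cinner (biframe_operator x y u) z"
proof -
  define g where "g z = (\<Sum>i. cinner u (x i) * cinner (y i) z)" for z
  define p where "p z = complex_of_real (q (u + z)) - complex_of_real (q (u + (-1) *\<^sub>C z))
    + \<i> * complex_of_real (q (u + \<i> *\<^sub>C z)) - \<i> * complex_of_real (q (u + (-\<i>) *\<^sub>C z))" for z
  have p_sums: "(\<lambda>i. 4 * (cinner u (x i) * cinner (y i) z)) sums p z" for z
    unfolding cinner_polarization p_def by (intro sums_add sums_diff sums_mult q)
  have "summable (\<lambda>i. cinner u (x i) * cinner (y i) z)" for z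
    using sums_mult[OF p_sums[of z], of "1/4"] by (simp add: sums_iff)
  then have g_sums: "(\<lambda>i. cinner u (x i) * cinner (y i) z) sums g z" for z
    unfolding g_def by (rule summable_sums)
  have g_eq: "4 * g z = p z" for z
    by (rule sums_unique2[OF sums_mult[OF g_sums] p_sums])
  have g_add: "g (a + b) = g a + g b" for a b
    using sums_unique2[OF g_sums[of "a + b"]] sums_add[OF g_sums[of a] g_sums[of b]]
    by (simp add: cinner_add_right distrib_left)
  have g_scaleC: "g (c *\<^sub>C a) = cnj c * g a" for a c
    using sums_unique2[OF g_sums[of "c *\<^sub>C a"]] sums_mult[OF g_sums[of a], of "cnj c"]
    by (simp add: cinner_scaleC_right mult_ac)
  have q_shift: "cmod (complex_of_real (q (u + c *\<^sub>C z))) \<le> B * (norm u + 1)\<^sup>2"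
    if "norm z = 1" "cmod c = 1" for z c
  proof -
    have "norm (u + c *\<^sub>C z) \<le> norm u + 1"
      using norm_triangle_ineq[of u "c *\<^sub>C z"] that by (simp add: norm_scaleC)
    then have "B * (norm (u + c *\<^sub>C z))\<^sup>2 \<le> B * (norm u + 1)\<^sup>2"
      using B by simp
    with q_le[of "u + c *\<^sub>C z"] q_nonneg[of "u + c *\<^sub>C z"] show ?thesis by simp
  qed
  have unit_bound: "cmod (g z) \<le> B * (norm u + 1)\<^sup>2" if "norm z = 1" for z
  proof -
    have one: "1 *\<^sub>C z = z" using scaleC_of_real[of 1 z] by simp
    have "cmod (4 * g z) \<le> cmod (complex_of_real (q (u + z)))
        + cmod (complex_of_real (q (u + (-1) *\<^sub>C z)))
        + cmod (\<i> * complex_of_real (q (u + \<i> *\<^sub>C z)))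
        + cmod (\<i> * complex_of_real (q (u + (-\<i>) *\<^sub>C z)))"
      unfolding g_eq p_def
      by (intro order_trans[OF norm_triangle_ineq4] add_mono
          order_trans[OF norm_triangle_ineq] order_refl)
    with q_shift[OF that, of 1] q_shift[OF that, of "-1"]
      q_shift[OF that, of \<i>] q_shift[OF that, of "-\<i>"]
    show ?thesis by (simp add: norm_mult one)
  qed
  \<comment> \<open>The polarized estimate is not homogeneous in \<open>z\<close>; it is used on the unit sphere only.\<close>
  have g_bound: "cmod (g z) \<le> norm z * (B * (norm u + 1)\<^sup>2)" for z
  proof (cases "z = 0")
    case True
    then show ?thesis using g_add[of 0 0] by simp
  next
    case False
    have "g z = complex_of_real (norm z) * g (sgn z)"
      using False g_scaleC[of "complex_of_real (norm z)" "sgn z"]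
      by (simp add: scaleC_of_real sgn_div_norm)
    then show ?thesis
      using unit_bound[of "sgn z"] False
      by (simp add: norm_mult norm_sgn mult_left_mono)
  qed
  have "bounded_linear g"
    by (rule bounded_linear_intro[OF g_add _ g_bound])
      (metis scaleC_of_real g_scaleC complex_cnj_complex_of_real scaleR_conv_of_real)
  moreover have "g (\<i> *\<^sub>C z) = - \<i> * g z" for z
    by (simp add: g_scaleC)
  ultimately obtain v where v: "\<And>z. g z = cinner v z"
    using riesz_representation_complex by blast
  have "\<exists>!v. \<forall>z. (\<lambda>i. cinner (cinner u (x i) *\<^sub>C y i) z) sums cinner v z"
  proof (rule ex1I)
    show v_sums: "\<forall>z. (\<lambda>i. cinner (cinner u (x i) *\<^sub>C y i) z) sums cinner v z"
      using g_sums by (simp add: cinner_scaleC_left v)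
    fix w assume "\<forall>z. (\<lambda>i. cinner (cinner u (x i) *\<^sub>C y i) z) sums cinner w z"
    with v_sums show "w = v"
      by (blast intro: cinner_left_ext[of w v] sums_unique2)
  qed
  from theI'[OF this] show ?thesis
    unfolding biframe_operator_def by (simp add: cinner_scaleC_left)
qed

section \<open>Characterization of K-biframes\<close>

theorem theorem3p11:
  fixes K :: "'a::complex_hilbert \<Rightarrow> 'a" and x y :: "nat \<Rightarrow> 'a"
  assumes "separable_space (euclidean :: 'a topology)"
    and "bounded_clinear K"
    and "biframe x y"
  shows "K_biframe K x y \<longleftrightarrow>
    (\<exists>A::real. A > 0 \<and>
      op_ge (biframe_operator x y) (\<lambda>u. complex_of_real A *\<^sub>C K (cadjoint K u)))"
proof -
  obtain A0 B where A0: "0 < A0" "A0 \<le> B"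
    and ex: "\<forall>u. \<exists>s::real. (\<lambda>i. cinner u (x i) * cinner (y i) u) sums complex_of_real s \<and>
        A0 * (norm (cadjoint (\<lambda>u. u) u))\<^sup>2 \<le> s \<and> s \<le> B * (norm u)\<^sup>2"
    using assms(3) unfolding biframe_def K_biframe_def by blast
  from choice[OF ex] obtain q where
    q: "\<And>u. (\<lambda>i. cinner u (x i) * cinner (y i) u) sums complex_of_real (q u)"
    and q_ge: "\<And>u. A0 * (norm (cadjoint (\<lambda>u. u) u))\<^sup>2 \<le> q u"
    and q_le: "\<And>u. q u \<le> B * (norm u)\<^sup>2"
    by blast
  have q_nonneg: "0 \<le> q u" for u
    by (rule order_trans[OF _ q_ge]) (use A0 in simp)
  have B: "0 < B" using A0 by linarith
  have S: "cinner (biframe_operator x y u) u = complex_of_real (q u)" for u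
    by (rule sums_unique2[OF biframe_operator_sums[OF q q_nonneg q_le B] q])
  have "cinner (complex_of_real A *\<^sub>C K (cadjoint K u)) u
      = complex_of_real (A * (norm (cadjoint K u))\<^sup>2)" for A u
    by (simp add: cinner_scaleC_left cinner_cadjoint[OF assms(2)] cinner_self)
  then have op_ge_iff: "op_ge (biframe_operator x y) (\<lambda>u. complex_of_real A *\<^sub>C K (cadjoint K u))
      \<longleftrightarrow> (\<forall>u. A * (norm (cadjoint K u))\<^sup>2 \<le> q u)" for A
    unfolding op_ge_def S by (simp add: less_eq_complex_def)
  show ?thesis
    unfolding op_ge_iff
  proof
    assume "K_biframe K x y"
    then obtain A where "0 < A" and A: "\<And>u. \<exists>s::real.
        (\<lambda>i. cinner u (x i) * cinner (y i) u) sums complex_of_real s \<and>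
        A * (norm (cadjoint K u))\<^sup>2 \<le> s"
      unfolding K_biframe_def by blast
    have "A * (norm (cadjoint K u))\<^sup>2 \<le> q u" for u
      using A[of u] sums_unique2[OF q[of u]] by (metis of_real_eq_iff)
    with \<open>0 < A\<close> show "\<exists>A>0. \<forall>u. A * (norm (cadjoint K u))\<^sup>2 \<le> q u"
      by blast
  next
    assume "\<exists>A>0. \<forall>u. A * (norm (cadjoint K u))\<^sup>2 \<le> q u"
    then obtain A where "0 < A" and A: "\<And>u. A * (norm (cadjoint K u))\<^sup>2 \<le> q u"
      by blast
    have "min A B * (norm (cadjoint K u))\<^sup>2 \<le> q u" for u
      by (rule order_trans[OF mult_right_mono A]) simp_all
    with q q_le \<open>0 < A\<close> B show "K_biframe K x y"
      unfolding K_biframe_def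
      by (intro exI[of _ "min A B"] exI[of _ B]) (auto intro!: exI[of _ "q _"])
  qed
qed

end
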